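(* Let $P$ be a regular game on $n$ players. Then $P$ is cyclic with a maximal cycle $\mathcal O$ if and only if $$P\sim\sum_{k=1}^K\mathrm{Disk}(u^k,v^k)$$ for some integer $K\ge1$ and some vectors $u^k,v^k\in\mathbb R^n$ ($k=1,\dots,K$), where each $\mathrm{Disk}(u^k,v^k)$ is cyclic and admits $\mathcal O$ as a maximal cycle.
   Context: A game on $n$ players is an antisymmetric real $n\times n$ matrix $P$ ($P=-P^T$) with entries in $[-1,1]$. $P$ is regular if $P_{ij}\neq0$ for all $i\ne j$. For antisymmetric matrices $P,Q$ of the same size, $P\sim Q$ means that $P_{ij}>0\Leftrightarrow Q_{ij}>0$ for all $i,j$. The following notions are used for any real antisymmetric $n\times n$ matrix $A$ (entries not necessarily in $[-1,1]$). Write $i\to j$ if $A_{ij}>0$. A cycle of length $R$ of $A$ is a set of (distinct) indices $i_1,\dots,i_R$ with $i_1\to i_2\to\cdots\to i_R\to i_1$. A maximal cycle is a cycle whose length is no less than that of any other cycle of $A$. $A$ is cyclic if there is a permutation $\gamma$ of $\{1,\dots,n\}$ such that $A_{\gamma(i)\gamma(i+1)}>0$ for all $1\le i\le n-1$ and $A_{\gamma(n)\gamma(1)}>0$ (so a cyclic matrix has maximal cycles of length $n$). A matrix admits $\mathcal O=(i_1\to\cdots\to i_R\to i_1)$ as a maximal cycle if these relations hold for that matrix and form a maximal cycle of it. For $u,v\in\mathbb R^n$, $\mathrm{Disk}(u,v):=uv^T-vu^T$. *)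

theory Defs
  imports "HOL-Analysis.Analysis"
begin

definition antisymmetric :: "real^'n^'n \<Rightarrow> bool" where
  "antisymmetric A \<longleftrightarrow> A = - transpose A"

definition game :: "real^'n^'n \<Rightarrow> bool" where
  "game P \<longleftrightarrow> antisymmetric P \<and> (\<forall>i j. P $ i $ j \<in> {-1..1})"

definition regular :: "real^'n^'n \<Rightarrow> bool" where
  "regular P \<longleftrightarrow> (\<forall>i j. i \<noteq> j \<longrightarrow> P $ i $ j \<noteq> 0)"

text \<open>Only meant to be applied to antisymmetric matrices, where it says that the entries of
  the two matrices have the same signs.\<close>

definition sign_equiv :: "real^'n^'n \<Rightarrow> real^'n^'n \<Rightarrow> bool"  (infix "\<sim>" 50) where
  "P \<sim> Q \<longleftrightarrow> (\<forall>i j. P $ i $ j > 0 \<longleftrightarrow> Q $ i $ j > 0)"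

text \<open>A cycle is given by the list of its successive indices, starting anywhere on the cycle;
  the \<open>mod\<close> closes it up.\<close>

definition cycle :: "real^'n^'n \<Rightarrow> 'n list \<Rightarrow> bool" where
  "cycle A c \<longleftrightarrow> c \<noteq> [] \<and> distinct c \<and>
     (\<forall>k<length c. A $ (c ! k) $ (c ! (Suc k mod length c)) > 0)"

definition maximal_cycle :: "real^'n^'n \<Rightarrow> 'n list \<Rightarrow> bool" where
  "maximal_cycle A c \<longleftrightarrow> cycle A c \<and> (\<forall>d. cycle A d \<longrightarrow> length d \<le> length c)"

text \<open>The index set is the finite type \<open>'n\<close>, so a permutation of \<open>{1..n}\<close> becomes an enumeration
  of \<open>'n\<close> by \<open>{1..n}\<close>, where \<open>n = CARD('n)\<close>.\<close>

definition cyclic :: "real^'n^'n \<Rightarrow> bool" where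
  "cyclic A \<longleftrightarrow> (\<exists>\<gamma>. bij_betw \<gamma> {1..CARD('n)} (UNIV :: 'n set) \<and>
     (\<forall>i. 1 \<le> i \<and> i < CARD('n) \<longrightarrow> A $ \<gamma> i $ \<gamma> (i + 1) > 0) \<and>
     A $ \<gamma> (CARD('n)) $ \<gamma> 1 > 0)"

definition Disk :: "real^'n \<Rightarrow> real^'n \<Rightarrow> real^'n^'n" where
  "Disk u v = (columnvector u :: real^1^'n) ** rowvector v
            - (columnvector v :: real^1^'n) ** rowvector u"

lemma Disk_nth [simp]: "Disk u v $ i $ j = u $ i * v $ j - v $ i * u $ j"
  by (simp add: Disk_def columnvector_def rowvector_def matrix_matrix_mult_def)

end

theory Submission
  imports Defs
begin

text \<open>The entry \<open>(i, j)\<close> of a disk is the cross product of the plane points \<open>w\<^sub>i = (u\<^sub>i, v\<^sub>i)\<close> and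
  \<open>w\<^sub>j\<close>, so rescaling the points by positive factors keeps all signs.  For each edge \<open>i \<rightarrow> j\<close> of
  \<open>P\<close> there is a disk that has the given Hamiltonian cycle and the edge \<open>i \<rightarrow> j\<close>; shrinking
  all points other than \<open>w\<^sub>i\<close> and \<open>w\<^sub>j\<close> makes that edge dominate all other entries.  The sum of
  these disks over all edges of \<open>P\<close> has the signs of \<open>P\<close>.\<close>

section \<open>Rotations of cycles and Hamiltonian cycles as lists\<close>

lemma cycle_rotate:
  assumes "cycle A c"
  shows "cycle A (rotate m c)"
proof -
  have "A $ (rotate m c ! k) $ (rotate m c ! (Suc k mod length c)) > 0" if "k < length c" for k
  proof -
    have "length c > 0" using that by linarith
    then have "(m + k) mod length c < length c" "Suc k mod length c < length c" by auto
    moreover have "(m + Suc k mod length c) mod length c = Suc ((m + k) mod length c) mod length c"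
      by (simp add: mod_simps)
    ultimately show ?thesis
      using assms that by (simp add: cycle_def nth_rotate)
  qed
  then show ?thesis
    using assms by (simp add: cycle_def)
qed

lemma cycle_rotate_iff: "cycle A (rotate m c) \<longleftrightarrow> cycle A c"
proof
  assume *: "cycle A (rotate m c)"
  \<comment> \<open>Rotating on by \<open>m * length c - m\<close> completes a whole number of
    turns; the truncated subtraction is harmless because \<open>c\<close> is nonempty.\<close>
  have "m * length c - m + m = m * length c" if "length c > 0"
    using that by (cases "length c") auto
  moreover have "length c > 0" using * by (auto simp: cycle_def)
  ultimately have "rotate (m * length c - m) (rotate m c) = c"
    by (metis rotate_rotate rotate_id mod_mult_self2_is_0)
  then show "cycle A c" using cycle_rotate[OF *] by metis
qed (rule cycle_rotate)

lemma length_cycle_le: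
  fixes A :: "real^'n^'n"
  assumes "cycle A c"
  shows "length c \<le> CARD('n)"
  using assms card_mono[of UNIV "set c"] by (simp add: cycle_def distinct_card)

lemma set_eq_UNIV_if_length_eq_CARD:
  fixes c :: "'n::finite list"
  assumes "distinct c" and "length c = CARD('n)"
  shows "set c = UNIV"
  using assms by (intro card_subset_eq) (simp_all add: distinct_card)

text \<open>Shifting indices by one matches the enumeration from 1 with list positions from 0; the
  closing edge is the position where \<open>mod\<close> wraps to 0.\<close>

lemma cyclic_iff_ex_cycle:
  fixes A :: "real^'n^'n"
  shows "cyclic A \<longleftrightarrow> (\<exists>c. cycle A c \<and> length c = CARD('n))"
proof
  assume "cyclic A"
  then obtain \<gamma> where \<gamma>: "bij_betw \<gamma> {1..CARD('n)} (UNIV :: 'n set)"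
    "\<And>i. 1 \<le> i \<Longrightarrow> i < CARD('n) \<Longrightarrow> A $ \<gamma> i $ \<gamma> (i + 1) > 0"
    "A $ \<gamma> (CARD('n)) $ \<gamma> 1 > 0"
    by (auto simp: cyclic_def)
  define c where "c = map (\<lambda>k. \<gamma> (Suc k)) [0..<CARD('n)]"
  have "A $ (c ! k) $ (c ! (Suc k mod length c)) > 0" if "k < length c" for k
  proof (cases "Suc k = CARD('n)")
    case True
    then show ?thesis using \<gamma>(3) that by (simp add: c_def)
  next
    case False
    then show ?thesis using \<gamma>(2)[of "Suc k"] that by (simp add: c_def)
  qed
  moreover have "distinct c"
    using inj_onD[OF bij_betw_imp_inj_on[OF \<gamma>(1)]]
    by (fastforce simp: c_def distinct_map intro!: inj_onI)
  ultimately show "\<exists>c. cycle A c \<and> length c = CARD('n)"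
    by (intro exI[of _ c]) (auto simp: cycle_def c_def)
next
  assume "\<exists>c. cycle A c \<and> length c = CARD('n)"
  then obtain c where c: "distinct c" "length c = CARD('n)"
    "\<And>k. k < length c \<Longrightarrow> A $ (c ! k) $ (c ! (Suc k mod length c)) > 0"
    by (auto simp: cycle_def)
  have "set c = UNIV"
    by (rule set_eq_UNIV_if_length_eq_CARD[OF c(1,2)])
  then have "bij_betw ((!) c) {..<CARD('n)} UNIV"
    using bij_betw_nth[OF c(1) _ refl] c(2) by metis
  moreover have "bij_betw (\<lambda>i. i - 1) {1..CARD('n)} {..<CARD('n)}"
    by (rule bij_betw_byWitness[where f' = Suc]) auto
  ultimately have "bij_betw (\<lambda>i. c ! (i - 1)) {1..CARD('n)} UNIV"
    using bij_betw_trans by (fastforce simp: o_def)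
  moreover have "A $ (c ! (i - 1)) $ (c ! (i + 1 - 1)) > 0" if "1 \<le> i \<and> i < CARD('n)" for i
  proof -
    have "i - 1 < length c" "Suc (i - 1) mod length c = i + 1 - 1" using that c(2) by auto
    then show ?thesis using c(3)[of "i - 1"] by metis
  qed
  moreover have "A $ (c ! (CARD('n) - 1)) $ (c ! (1 - 1)) > 0"
  proof -
    have "CARD('n) - 1 < length c" "Suc (CARD('n) - 1) mod length c = 1 - 1"
      using c(2) by (simp_all add: Suc_diff_1)
    then show ?thesis using c(3)[of "CARD('n) - 1"] by metis
  qed
  ultimately show "cyclic A"
    unfolding cyclic_def by blast
qed

text \<open>Cycles have at most \<open>CARD('n)\<close> vertices, so once some cycle attains this
  bound, the maximal ones are exactly those attaining it. This reduces the theorem to Hamiltonian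
  cycles.\<close>

lemma cyclic_maximal_cycle_iff:
  fixes A :: "real^'n^'n"
  shows "cyclic A \<and> maximal_cycle A c \<longleftrightarrow> cycle A c \<and> length c = CARD('n)"
  unfolding cyclic_iff_ex_cycle maximal_cycle_def
  by (metis length_cycle_le order_antisym)

lemma antisymmetric_nth:
  assumes "antisymmetric A"
  shows "A $ i $ j = - A $ j $ i"
proof -
  have "A $ i $ j = (- transpose A) $ i $ j"
    using assms by (simp add: antisymmetric_def)
  then show ?thesis by (simp add: transpose_def)
qed

section \<open>Disks with a prescribed Hamiltonian cycle and edge\<close>

lemma ex_Disk_cycle_edge_from_start:
  fixes d :: "'n::finite list"
  assumes "distinct d" and "length d = CARD('n)" and "1 \<le> k" and "k + 2 \<le> length d"
  shows "\<exists>u v. cycle (Disk u v) d \<and> Disk u v $ (d ! 0) $ (d ! k) > 0"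
proof -
  define pos where "pos = the_inv_into {..<length d} ((!) d)"
  have pos: "pos (d ! t) = t" if "t < length d" for t
    unfolding pos_def using assms(1) that
    by (intro the_inv_into_f_f) (auto simp: inj_on_def nth_eq_iff_index_eq)
  text \<open>The points \<open>w\<^sub>1, \<dots>, w\<^sub>k\<close> move left on the line \<open>y = 1\<close>, and the later ones move right on
    the line \<open>y = -1\<close>, starting from \<open>w\<^sub>0 = (1, 0)\<close>.\<close>
  define x :: "nat \<Rightarrow> real" where
    "x t = (if t = 0 then 1 else if t \<le> k then - real t else real t - 2)" for t
  define y :: "nat \<Rightarrow> real" where
    "y t = (if t = 0 then 0 else if t \<le> k then 1 else - 1)" for t
  define u :: "real^'n" where "u = (\<chi> i. x (pos i))"
  define v :: "real^'n" where "v = (\<chi> i. y (pos i))"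
  have "d \<noteq> []" using assms(4) by auto
  have D: "Disk u v $ (d ! s) $ (d ! t) = x s * y t - y s * x t"
    if "s < length d" "t < length d" for s t
    using that by (simp add: u_def v_def pos)
  \<comment> \<open>All these cross products equal 1; the offset in \<open>real t - 2\<close>
    achieves this at the jump from \<open>k\<close> to \<open>k + 1\<close>. The closing edge needs
    the last point on the line y = -1, hence \<open>k + 2 \<le> length d\<close>.\<close>
  have "Disk u v $ (d ! s) $ (d ! (Suc s mod length d)) > 0" if "s < length d" for s
  proof (cases "Suc s = length d")
    case True
    then show ?thesis using D[of s 0] that assms(3,4) \<open>d \<noteq> []\<close>
      by (simp add: x_def y_def del: Disk_nth)
  next
    case False
    then show ?thesis using D[of s "Suc s"] that assms(3,4) by (auto simp: x_def y_def simp del: Disk_nth)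
  qed
  then have "cycle (Disk u v) d"
    using assms by (auto simp: cycle_def)
  moreover have "Disk u v $ (d ! 0) $ (d ! k) > 0"
    using D[of 0 k] assms(3,4) \<open>d \<noteq> []\<close> by (simp add: x_def y_def del: Disk_nth)
  ultimately show ?thesis by blast
qed

text \<open>Rotate \<open>c\<close> so that \<open>i\<close> comes first. The positions of
  \<open>j\<close> excluded in the previous lemma are the first and the last; there antisymmetry of
  \<open>P\<close> would contradict the edge from \<open>i\<close> to \<open>j\<close>.\<close>

lemma ex_Disk_cycle_edge:
  fixes P :: "real^'n^'n"
  assumes P: "antisymmetric P" and c: "cycle P c" "length c = CARD('n)" and ij: "P $ i $ j > 0"
  shows "\<exists>u v. cycle (Disk u v) c \<and> Disk u v $ i $ j > 0"
proof -
  have dist: "distinct c" using c by (simp add: cycle_def)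
  then have "set c = UNIV"
    using c(2) by (rule set_eq_UNIV_if_length_eq_CARD)
  then obtain m where m: "m < length c" "c ! m = i" by (metis UNIV_I in_set_conv_nth)
  define d where "d = rotate m c"
  have d: "cycle P d" "length d = CARD('n)" "distinct d"
    using c dist by (simp_all add: d_def cycle_rotate)
  have d0: "d ! 0 = i" using m nth_rotate[of 0 c m] by (cases c) (auto simp: d_def)
  obtain k where k: "k < length d" "d ! k = j"
    using \<open>set c = UNIV\<close> by (metis UNIV_I d_def in_set_conv_nth set_rotate)
  have "k \<noteq> 0"
    using k d0 ij antisymmetric_nth[OF P, of i i] by (intro notI) simp
  moreover have "Suc k \<noteq> length d"
  proof
    assume *: "Suc k = length d"
    then have "P $ (d ! k) $ (d ! (Suc k mod length d)) > 0"
      using d(1) k(1) unfolding cycle_def by blast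
    then have "P $ j $ i > 0"
      using * k d0 by simp
    then show False using ij antisymmetric_nth[OF P, of i j] by simp
  qed
  ultimately obtain u v where "cycle (Disk u v) d" "Disk u v $ (d ! 0) $ (d ! k) > 0"
    using ex_Disk_cycle_edge_from_start[OF d(3,2), of k] k by auto
  then show ?thesis using d0 k by (metis cycle_rotate_iff d_def)
qed

lemma ex_Disk_cycle_dominant_edge:
  fixes P :: "real^'n^'n"
  assumes P: "antisymmetric P" and c: "cycle P c" "length c = CARD('n)" and ij: "P $ i $ j > 0"
    and \<epsilon>: "\<epsilon> > 0"
  shows "\<exists>u v. cycle (Disk u v) c \<and> Disk u v $ i $ j = 1 \<and>
    (\<forall>a b. {a, b} \<noteq> {i, j} \<longrightarrow> \<bar>Disk u v $ a $ b\<bar> \<le> \<epsilon>)"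
proof -
  obtain u v where uv: "cycle (Disk u v) c" "Disk u v $ i $ j > 0"
    using ex_Disk_cycle_edge[OF P c ij] by blast
  define s where "s = Disk u v $ i $ j"
  \<comment> \<open>\<open>M\<close> bounds every entry of the disk divided by \<open>s\<close>, so
    an entry scaled by at most \<delta> stays within \<epsilon>. The cap \<delta> \<le> 1 covers
    entries with both indices shrunk, whose factor is the square of \<delta>.\<close>
  define M where "M = norm (Disk u v) / s + 1"
  define \<delta> where "\<delta> = min 1 (\<epsilon> / M)"
  define r where "r = (\<lambda>a. if a \<in> {i, j} then 1 else \<delta>)"
  \<comment> \<open>By bilinearity, dividing only \<open>u\<close> by \<open>s\<close> normalises
    the entry at \<open>(i, j)\<close> to 1.\<close>
  define u' :: "real^'n" where "u' = (\<chi> a. r a * u $ a / s)"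
  define v' :: "real^'n" where "v' = (\<chi> a. r a * v $ a)"
  have s: "s > 0" using uv by (simp add: s_def)
  then have M: "M > 0" by (simp add: M_def add_nonneg_pos)
  then have \<delta>: "0 < \<delta>" "\<delta> \<le> 1" "\<delta> * M \<le> \<epsilon>"
    using \<epsilon> by (auto simp: \<delta>_def min_def field_simps)
  have r: "0 < r a" "r a \<le> 1" for a using \<delta> by (auto simp: r_def)
  have D: "Disk u' v' $ a $ b = r a * r b * (Disk u v $ a $ b / s)" for a b
    using s by (simp add: u'_def v'_def field_simps)
  have "Disk u v $ a $ b > 0 \<Longrightarrow> Disk u' v' $ a $ b > 0" for a b
    unfolding D using r s by simp
  then have "cycle (Disk u' v') c"
    using uv(1) unfolding cycle_def by blast
  moreover have "Disk u' v' $ i $ j = 1"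
    unfolding D using s by (simp add: r_def flip: s_def del: Disk_nth)
  moreover have "\<bar>Disk u' v' $ a $ b\<bar> \<le> \<epsilon>" if ab: "{a, b} \<noteq> {i, j}" for a b
  proof (cases "a = b")
    \<comment> \<open>Here \<open>a\<close> may be \<open>i\<close> or \<open>j\<close>, so nothing
      need shrink; but diagonal entries of a disk vanish.\<close>
    case True
    then show ?thesis using \<epsilon> by simp
  next
    case False
    then have "a \<notin> {i, j} \<or> b \<notin> {i, j}" using ab by auto
    then have "r a * r b \<le> \<delta>"
      using \<delta> by (auto simp: r_def mult_left_le)
    have "\<bar>Disk u v $ a $ b\<bar> \<le> norm (Disk u v)"
      using component_le_norm_cart[of "Disk u v $ a" b] Finite_Cartesian_Product.norm_nth_le[of "Disk u v" a] by linarith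
    then have "\<bar>Disk u v $ a $ b / s\<bar> \<le> norm (Disk u v) / s"
      using s by (simp add: divide_right_mono del: Disk_nth)
    also have "\<dots> \<le> M" by (simp add: M_def)
    finally have "\<bar>Disk u v $ a $ b / s\<bar> \<le> M" .
    then have "(r a * r b) * \<bar>Disk u v $ a $ b / s\<bar> \<le> \<delta> * M"
      using \<open>r a * r b \<le> \<delta>\<close> \<delta> by (intro mult_mono) auto
    moreover have "\<bar>Disk u' v' $ a $ b\<bar> = (r a * r b) * \<bar>Disk u v $ a $ b / s\<bar>"
      unfolding D abs_mult using r[of a] r[of b] by simp
    ultimately show ?thesis using \<delta>(3) by linarith
  qed
  ultimately show ?thesis by blast
qed

section \<open>Summing over the edges, and the converse\<close>

lemma ex_sign_equiv_sum_Disk: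
  fixes P :: "real^'n^'n"
  assumes P: "antisymmetric P" "regular P" and c: "cycle P c" "length c = CARD('n)"
  shows "\<exists>(K::nat) u v. K \<ge> 1 \<and> P \<sim> (\<Sum>k=1..K. Disk (u k) (v k)) \<and>
    (\<forall>k\<in>{1..K}. cycle (Disk (u k) (v k)) c)"
proof -
  define E where "E = {(i, j). P $ i $ j > 0}"
  define K where "K = card E"
  have "P $ (c ! 0) $ (c ! (Suc 0 mod length c)) > 0"
    using c(1) by (auto simp: cycle_def)
  then have "E \<noteq> {}" by (auto simp: E_def)
  then have K: "K \<ge> 1" by (simp add: K_def Suc_le_eq card_gt_0_iff)
  obtain e where e: "bij_betw e {1..K} E"
    using ex_bij_betw_nat_finite_1[of E] by (auto simp: K_def)
  have "\<exists>u v. cycle (Disk u v) c \<and> Disk u v $ fst p $ snd p = 1 \<and>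
    (\<forall>a b. {a, b} \<noteq> {fst p, snd p} \<longrightarrow> \<bar>Disk u v $ a $ b\<bar> \<le> 1 / K)" if "p \<in> E" for p
    using ex_Disk_cycle_dominant_edge[OF P(1) c, of "fst p" "snd p" "1 / K"] that K
    by (auto simp: E_def)
  then obtain U V where UV: "\<And>p. p \<in> E \<Longrightarrow> cycle (Disk (U p) (V p)) c"
    "\<And>p. p \<in> E \<Longrightarrow> Disk (U p) (V p) $ fst p $ snd p = 1"
    "\<And>p a b. p \<in> E \<Longrightarrow> {a, b} \<noteq> {fst p, snd p} \<Longrightarrow> \<bar>Disk (U p) (V p) $ a $ b\<bar> \<le> 1 / K"
    by metis
  define S where "S = (\<Sum>k=1..K. Disk (U (e k)) (V (e k)))"
  have S: "S = (\<Sum>p\<in>E. Disk (U p) (V p))"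
    unfolding S_def using e by (rule sum.reindex_bij_betw)
  have S_pos: "S $ i $ j > 0" if "P $ i $ j > 0" for i j
  proof -
    have ij: "(i, j) \<in> E" using that by (simp add: E_def)
    \<comment> \<open>Antisymmetry keeps \<open>(j, i)\<close> out of \<open>E\<close>, so only the
      disk of \<open>(i, j)\<close> itself is dominant at this entry.\<close>
    have "{i, j} \<noteq> {fst p, snd p}" if p: "p \<in> E - {(i, j)}" for p
    proof
      assume "{i, j} = {fst p, snd p}"
      then have "p = (j, i)" using p by (cases p) (auto simp: doubleton_eq_iff)
      then have "P $ j $ i > 0" using p by (simp add: E_def)
      then show False using \<open>P $ i $ j > 0\<close> antisymmetric_nth[OF P(1), of i j] by simp
    qed
    then have "- (1 / K) \<le> Disk (U p) (V p) $ i $ j" if "p \<in> E - {(i, j)}" for p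
      using UV(3)[of p i j] that by (simp del: Disk_nth)
    then have "(\<Sum>p\<in>E - {(i, j)}. Disk (U p) (V p) $ i $ j) \<ge> (\<Sum>p\<in>E - {(i, j)}. - (1 / K))"
      by (rule sum_mono)
    \<comment> \<open>There are \<open>K - 1\<close> other edges, each contributing at least -1/K,
      so together they cannot cancel the dominant 1.\<close>
    moreover have "(\<Sum>p\<in>E - {(i, j)}. - (1 / K)) > - 1"
      using ij K by (simp add: K_def field_simps)
    moreover have "S $ i $ j = 1 + (\<Sum>p\<in>E - {(i, j)}. Disk (U p) (V p) $ i $ j)"
      unfolding S using UV(2)[OF ij] sum.remove[OF _ ij, of "\<lambda>p. Disk (U p) (V p) $ i $ j"]
      by (simp del: Disk_nth)
    ultimately show ?thesis by linarith
  qed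
  have S_anti: "S $ i $ j = - S $ j $ i" for i j
    unfolding S by (simp flip: sum_negf add: mult.commute)
  \<comment> \<open>By regularity, a missing edge between distinct indices is present in reverse,
    where \<open>S\<close> is already known to be positive.\<close>
  have "P $ i $ j > 0" if "S $ i $ j > 0" for i j
  proof (rule ccontr)
    assume not: "\<not> P $ i $ j > 0"
    have "i \<noteq> j" using that S_anti[of i i] by (intro notI) simp
    then have "P $ j $ i > 0"
      using not P(2) antisymmetric_nth[OF P(1), of i j] by (auto simp: regular_def less_le)
    then show False using S_pos[of j i] that S_anti[of i j] by simp
  qed
  with S_pos have "P \<sim> S" by (auto simp: sign_equiv_def)
  moreover have "\<forall>k\<in>{1..K}. cycle (Disk (U (e k)) (V (e k))) c"
    using UV(1) bij_betwE[OF e] by blast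
  ultimately show ?thesis
    using K unfolding S_def
    by (intro exI[of _ K] exI[of _ "\<lambda>k. U (e k)"] exI[of _ "\<lambda>k. V (e k)"]) simp
qed

text \<open>Positivity along the edges of \<open>c\<close> passes from the summands to the sum and
  then to \<open>P\<close>. That \<open>I\<close> is nonempty makes the sum strictly positive and
  provides a summand showing that \<open>c\<close> is nonempty and distinct.\<close>

lemma cycle_sign_equiv_sum:
  assumes "P \<sim> (\<Sum>k\<in>I. A k)" and "finite I" and "I \<noteq> {}" and "\<And>k. k \<in> I \<Longrightarrow> cycle (A k) c"
  shows "cycle P c"
proof -
  have "(\<Sum>k\<in>I. A k) $ (c ! m) $ (c ! (Suc m mod length c)) > 0" if "m < length c" for m
    using assms(2-4) that by (auto simp: cycle_def intro!: sum_pos)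
  then show ?thesis
    using assms(1,3,4) by (auto simp: cycle_def sign_equiv_def)
qed

theorem theorem3:
  fixes P :: "real^'n^'n" and \<O> :: "'n list"
  assumes "game P" and "regular P"
  shows "(cyclic P \<and> maximal_cycle P \<O>) \<longleftrightarrow>
    (\<exists>(K::nat) (u :: nat \<Rightarrow> real^'n) (v :: nat \<Rightarrow> real^'n). K \<ge> 1 \<and>
       P \<sim> (\<Sum>k=1..K. Disk (u k) (v k)) \<and>
       (\<forall>k\<in>{1..K}. cyclic (Disk (u k) (v k)) \<and> maximal_cycle (Disk (u k) (v k)) \<O>))"
  unfolding cyclic_maximal_cycle_iff
proof
  assume "cycle P \<O> \<and> length \<O> = CARD('n)"
  then show "\<exists>(K::nat) u v. K \<ge> 1 \<and> P \<sim> (\<Sum>k=1..K. Disk (u k) (v k)) \<and>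
      (\<forall>k\<in>{1..K}. cycle (Disk (u k) (v k)) \<O> \<and> length \<O> = CARD('n))"
    using ex_sign_equiv_sum_Disk[of P \<O>] assms by (simp add: game_def)
next
  assume "\<exists>(K::nat) u v. K \<ge> 1 \<and> P \<sim> (\<Sum>k=1..K. Disk (u k) (v k)) \<and>
      (\<forall>k\<in>{1..K}. cycle (Disk (u k) (v k)) \<O> \<and> length \<O> = CARD('n))"
  then obtain K :: nat and u v where K: "K \<ge> 1" "P \<sim> (\<Sum>k=1..K. Disk (u k) (v k))"
    "\<And>k. k \<in> {1..K} \<Longrightarrow> cycle (Disk (u k) (v k)) \<O> \<and> length \<O> = CARD('n)"
    by blast
  then have "cycle P \<O>"
    using cycle_sign_equiv_sum[of P "\<lambda>k. Disk (u k) (v k)" "{1..K}"] by simp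
  then show "cycle P \<O> \<and> length \<O> = CARD('n)"
    using K(1) K(3)[of 1] by simp
qed

end
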